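(* Let $p$ be a prime number and let $\alpha,\beta\in(0,1]$ be real numbers. The asymptotic densities of $C_p'$ and $D_p'$ are $$\lim_{R\to\infty}\frac{\#\left(C'_{p}\cap ([-\alpha R,\alpha R]\times [-\beta R,\beta R])\right)}{(2\alpha R)(2\beta R)} = \lim_{R\to\infty}\frac{\#\left(D_{p}'\cap ([-\alpha R,\alpha R]\times [-\beta R,\beta R])\right)}{(2\alpha R)(2\beta R)} = \frac{6}{\pi^2}\cdot \frac{p}{p+1},$$ and the asymptotic density of $E_p'$ is $$\lim_{R\to\infty}\frac{\#\left(E'_{p}\cap ([-\alpha R,\alpha R]\times [-\beta R,\beta R])\right)}{(2\alpha R)(2\beta R)} = \frac{6}{\pi^2}\cdot \frac{p-1}{p+1}.$$
   Context: Let $\mathbb{Z}^2_{prim} = \left\{\begin{pmatrix} a\\ b \end{pmatrix}\in \mathbb{Z}^2: \gcd(a,b) = 1\right\}$ (with $\gcd(a,0)=|a|$). For a prime $p$ define $$C_p'=\left\{\begin{pmatrix} a\\ b \end{pmatrix}\in \mathbb{Z}^2_{prim}: a\not\equiv 0\bmod p\right\},\qquad D_p'=\left\{\begin{pmatrix} a\\ b \end{pmatrix}\in \mathbb{Z}^2_{prim}: b\not\equiv 0\bmod p\right\},$$ $$E_p'=C_p'\cap D_p'=\left\{\begin{pmatrix} a\\ b \end{pmatrix}\in \mathbb{Z}^2_{prim}: a\not\equiv 0\bmod p\text{ and } b\not\equiv 0\bmod p\right\}.$$ $\#$ denotes cardinality. *)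

theory Defs
  imports "HOL-Analysis.Analysis" "HOL-Number_Theory.Cong"
begin

definition prim_vecs :: "(int \<times> int) set" where
  "prim_vecs = {(a, b). gcd a b = 1}"

definition C_prim :: "nat \<Rightarrow> (int \<times> int) set" where
  "C_prim p = {(a, b) \<in> prim_vecs. \<not> [a = 0] (mod int p)}"

definition D_prim :: "nat \<Rightarrow> (int \<times> int) set" where
  "D_prim p = {(a, b) \<in> prim_vecs. \<not> [b = 0] (mod int p)}"

definition E_prim :: "nat \<Rightarrow> (int \<times> int) set" where
  "E_prim p = C_prim p \<inter> D_prim p"

definition lattice_box :: "real \<Rightarrow> real \<Rightarrow> (int \<times> int) set" where
  "lattice_box x y = {(a, b). real_of_int a \<in> {-x..x} \<and> real_of_int b \<in> {-y..y}}"

text \<open>Counting lattice points of a box with \<^const>\<open>card\<close> is meaningful: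
  the value 0 for infinite sets never occurs.\<close>

lemma finite_lattice_box: "finite (lattice_box x y)"
proof (rule finite_subset)
  show "lattice_box x y \<subseteq> {\<lceil>-x\<rceil>..\<lfloor>x\<rfloor>} \<times> {\<lceil>-y\<rceil>..\<lfloor>y\<rfloor>}"
    by (auto simp: lattice_box_def ceiling_le_iff le_floor_iff)
qed simp

end

theory Submission
  imports Defs "HOL-Real_Asymp.Real_Asymp"
begin

text \<open>
  Let \<open>P\<close> be one of the three sets of all integer points, primitive or not, on which the
  coordinate \<open>a\<close>, the coordinate \<open>b\<close>, or both are not divisible by \<open>p\<close>.  Each point of \<open>P\<close> is
  \<open>d\<close> times a primitive point, where \<open>d\<close> is its gcd; here \<open>d\<close> is prime to \<open>p\<close> and the primitive
  point lies in \<open>P\<close> again.  Conversely, multiplying a point of \<open>P\<close> by any \<open>d \<ge> 1\<close> prime to \<open>p\<close>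
  stays in \<open>P\<close>.  So if \<open>F R\<close> counts the points of \<open>P\<close> in the box with parameter \<open>R\<close>, and \<open>f R\<close>
  the primitive ones, then \<open>F R\<close> is the sum of \<open>f (R / d)\<close> over all \<open>d \<ge> 1\<close> prime to \<open>p\<close>
  (\<open>card_eq_sum_primitive\<close>).  Divided by the area \<open>4 \<alpha> \<beta> R\<^sup>2\<close>, this expresses the normalised
  count \<open>G\<close> of \<open>P\<close> as a sum of dilates \<open>g (R / d)\<close> of the normalised primitive count \<open>g\<close>, with
  weights \<open>1 / d\<^sup>2\<close>.

  The limit of \<open>G\<close> is elementary: \<open>P\<close> is a product set, so it suffices to count the multiples
  of \<open>p\<close> in an interval, and the limit is a product of factors \<open>1\<close> and \<open>1 - 1 / p\<close>.

  To pass from \<open>G\<close> back to \<open>g\<close> one could use Moebius inversion, but a contraction argument is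
  enough (\<open>tendsto_of_dilation_sum\<close>): the term \<open>d = 1\<close> has weight 1, all other weights together
  have sum at most \<open>\<pi>\<^sup>2 / 6 - 1 < 1\<close>, and so the oscillation of \<open>g\<close> around its expected limit
  is bounded by a proper fraction of itself.  The limit of \<open>g\<close> is therefore the limit of \<open>G\<close>
  divided by the total weight, which is \<open>\<zeta>(2)\<close> without its Euler factor at \<open>p\<close>, that is,
  \<open>\<pi>\<^sup>2 / 6 * (1 - 1 / p\<^sup>2)\<close>.  Cancelling \<open>1 - 1 / p\<close> gives the stated values.
\<close>

section \<open>Inverting a sum over dilations\<close>

text \<open>
  If \<open>g\<close> has a limit, dominated convergence shows that it must be \<open>l = c / W\<close>.  To get
  convergence, isolate the term \<open>d = 1\<close> in the sum for \<open>h = g - l\<close>: up to an error tending to 0,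
  \<open>h x\<close> is minus the sum of \<open>w d * h (x / d)\<close> over \<open>d \<noteq> 1\<close>.  These weights have sum
  \<open>W - 1 < 1\<close>, so an eventual bound \<open>M\<close> for \<open>\<bar>h\<bar>\<close> improves to \<open>M * (W / 2)\<close>.  Iterating from
  the bound given by the boundedness of \<open>g\<close> forces \<open>h\<close> to tend to 0.
\<close>

lemma tendsto_of_dilation_sum:
  fixes g :: "real \<Rightarrow> real" and w :: "nat \<Rightarrow> real"
  assumes w_nonneg: "\<And>d. 0 \<le> w d" and w0: "w 0 = 0" and w1: "w 1 = 1"
    and w_sums: "w sums W" and "W < 2"
    and g_bound: "\<And>x. 0 < x \<Longrightarrow> \<bar>g x\<bar> \<le> B"
    and lim: "((\<lambda>x. \<Sum>d. w d * g (x / real d)) \<longlongrightarrow> c) at_top"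
  shows "(g \<longlongrightarrow> c / W) at_top"
proof -
  define l where "l = c / W"
  define h where "h = (\<lambda>x. g x - l)"
  define G where "G = (\<lambda>x. \<Sum>d. w d * g (x / real d))"
  define K where "K = \<bar>B\<bar> + \<bar>l\<bar> + 1"
  define w' where "w' = (\<lambda>d. if d = 1 then 0 else w d)"
  \<comment> \<open>The room between the contraction factor \<open>W - 1\<close> and the factor \<open>W / 2 < 1\<close> that is claimed
    for one step; half of it pays for the tail of the series, half for \<open>G - c\<close>.\<close>
  define s where "s = 1 - W / 2"
  have "1 \<le> W"
    using sum_le_suminf[of w "{1}"] w_sums w_nonneg w1 by (simp add: sums_iff)
  then have lW: "l * W = c" by (simp add: l_def)
  have s: "0 < s" using \<open>W < 2\<close> by (simp add: s_def)
  have K: "0 < K" by (simp add: K_def)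
  have hK: "\<bar>h x\<bar> \<le> K" if "0 < x" for x
    using g_bound[OF that] by (auto simp: h_def K_def)
  have w'_sums: "w' sums (W - 1)"
  proof -
    have "(\<lambda>d. if d = 1 then 1 else 0 :: real) sums 1"
      using sums_single[of 1 "\<lambda>_. 1 :: real"] by simp
    from sums_diff[OF w_sums this] show ?thesis
      by (rule sums_cong[THEN iffD1, rotated]) (use w1 in \<open>auto simp: w'_def\<close>)
  qed
  have w'_nonneg: "0 \<le> w' d" for d using w_nonneg by (simp add: w'_def)
  have term_bound: "\<bar>w' d * h (x / real d)\<bar> \<le> w' d * K" if "0 < x" for x d
  proof (cases "d = 0")
    case True
    then show ?thesis by (simp add: w'_def w0)
  next
    case False
    then have "\<bar>h (x / real d)\<bar> \<le> K" using that by (intro hK) simp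
    then show ?thesis using w'_nonneg[of d] by (simp add: abs_mult mult_left_mono)
  qed
  have summable_h: "summable (\<lambda>d. \<bar>w' d * h (x / real d)\<bar>)" if "0 < x" for x
    by (rule summable_comparison_test'[where N = 0 and g = "\<lambda>d. w' d * K"])
      (use w'_sums term_bound[OF that] in \<open>auto intro: summable_mult2 simp: sums_iff\<close>)
  have h_eq: "h x = (G x - c) - (\<Sum>d. w' d * h (x / real d))" if "0 < x" for x
  proof -
    have 1: "(\<lambda>d. w' d * h (x / real d)) sums (\<Sum>d. w' d * h (x / real d))"
      using summable_rabs_cancel[OF summable_h[OF that]] by (simp add: summable_sums)
    have 2: "(\<lambda>d. if d = 1 then h x else 0) sums h x"
      using sums_single[of 1 "\<lambda>_. h x"] by simp
    have 3: "(\<lambda>d. l * w d) sums (l * W)"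
      using w_sums by (rule sums_mult)
    have "(\<lambda>d. w' d * h (x / real d) + (if d = 1 then h x else 0) + l * w d) =
        (\<lambda>d. w d * g (x / real d))"
      by (rule ext) (use w1 in \<open>auto simp: w'_def h_def algebra_simps\<close>)
    with sums_add[OF sums_add[OF 1 2] 3]
    have "G x = (\<Sum>d. w' d * h (x / real d)) + h x + l * W"
      unfolding G_def by (simp add: sums_iff)
    then show ?thesis using lW by simp
  qed

  have step: "\<forall>\<^sub>F x in at_top. \<bar>h x\<bar> \<le> M * (W / 2)"
    if M: "0 < M" and ev: "\<forall>\<^sub>F x in at_top. \<bar>h x\<bar> \<le> M" for M
  proof -
    have "0 < s * M / 2 / K" using s M K by simp
    \<comment> \<open>An eventual bound controls only finitely many of the values \<open>h (x / d)\<close>, those with \<open>x / d\<close>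
      large.  On the remaining tail the global bound \<open>K\<close> is used.\<close>
    from suminf_exist_split[OF this, of w'] w'_sums
    obtain N where N: "\<bar>\<Sum>d. w' (d + N)\<bar> < s * M / 2 / K"
      by (auto simp: sums_iff)
    obtain X where X: "\<And>x. X \<le> x \<Longrightarrow> \<bar>h x\<bar> \<le> M"
      using ev by (auto simp: eventually_at_top_linorder)
    have evG: "\<forall>\<^sub>F x in at_top. \<bar>G x - c\<bar> < s * M / 2"
      using tendstoD[OF lim, of "s * M / 2"] s M by (simp add: G_def dist_real_def)
    show ?thesis
      using evG eventually_gt_at_top[of 0] eventually_ge_at_top[of "\<bar>X\<bar> * real N"]
    proof eventually_elim
      case (elim x)
      let ?v = "\<lambda>d. \<bar>w' d * h (x / real d)\<bar>"
      have sv: "summable ?v" using summable_h elim by simp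
      have sw: "summable w'" using w'_sums by (simp add: sums_iff)
      have "(\<Sum>d<N. ?v d) \<le> (\<Sum>d<N. w' d * M)"
      proof (rule sum_mono)
        fix d assume d: "d \<in> {..<N}"
        show "?v d \<le> w' d * M"
        proof (cases "d = 0")
          case True
          then show ?thesis by (simp add: w'_def w0)
        next
          case False
          have "\<bar>X\<bar> * real d \<le> \<bar>X\<bar> * real N" using d by (intro mult_left_mono) auto
          then have "X * real d \<le> x"
            using elim(3) mult_right_mono[OF abs_ge_self[of X], of "real d"] by linarith
          then have "X \<le> x / real d" using False by (simp add: pos_le_divide_eq)
          then show ?thesis using X w'_nonneg[of d] by (simp add: abs_mult mult_left_mono)
        qed
      qed
      also have "\<dots> \<le> (W - 1) * M"
        using sum_le_suminf[OF sw, of "{..<N}"] w'_nonneg w'_sums M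
        by (simp add: sum_distrib_right[symmetric] sums_iff)
      finally have head: "(\<Sum>d<N. ?v d) \<le> (W - 1) * M" .
      have "(\<Sum>d. ?v (d + N)) \<le> (\<Sum>d. w' (d + N) * K)"
      proof (rule suminf_le)
        show "?v (d + N) \<le> w' (d + N) * K" for d using term_bound[of x "d + N"] elim by simp
        show "summable (\<lambda>d. ?v (d + N))"
          using summable_ignore_initial_segment[OF sv] by simp
        show "summable (\<lambda>d. w' (d + N) * K)"
          using summable_ignore_initial_segment[OF sw] by (rule summable_mult2)
      qed
      also have "\<dots> = (\<Sum>d. w' (d + N)) * K"
        using summable_ignore_initial_segment[OF sw] by (rule suminf_mult2[symmetric])
      also have "\<dots> \<le> s * M / 2"
      proof -
        have "(\<Sum>d. w' (d + N)) \<le> s * M / 2 / K" using N by linarith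
        then show ?thesis using K by (simp add: pos_le_divide_eq)
      qed
      finally have tail: "(\<Sum>d. ?v (d + N)) \<le> s * M / 2" .
      have "\<bar>\<Sum>d. w' d * h (x / real d)\<bar> \<le> suminf ?v"
        using summable_rabs[OF sv] .
      also have "\<dots> \<le> (W - 1) * M + s * M / 2"
        using suminf_split_initial_segment[OF sv, of N] head tail by simp
      finally have "\<bar>h x\<bar> \<le> s * M / 2 + ((W - 1) * M + s * M / 2)"
        using h_eq[of x] elim by linarith
      also have "\<dots> = M * (W / 2)" by (simp add: s_def field_simps)
      finally show ?case .
    qed
  qed

  have iter: "\<forall>\<^sub>F x in at_top. \<bar>h x\<bar> \<le> K * (W / 2) ^ n" for n
  proof (induction n)
    case 0
    show ?case using eventually_gt_at_top[of 0] by eventually_elim (simp add: hK)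
  next
    case (Suc n)
    have "0 < K * (W / 2) ^ n" using K \<open>1 \<le> W\<close> by simp
    from step[OF this Suc] show ?case by (simp add: mult_ac)
  qed
  have "(h \<longlongrightarrow> 0) at_top"
  proof (rule tendstoI)
    fix e :: real assume e: "0 < e"
    have "(\<lambda>n. K * (W / 2) ^ n) \<longlonglongrightarrow> K * 0"
      using \<open>1 \<le> W\<close> \<open>W < 2\<close> by (intro tendsto_mult tendsto_const LIMSEQ_realpow_zero) auto
    from order_tendstoD(2)[OF this, of e] e
    obtain n where n: "K * (W / 2) ^ n < e" by (auto simp: eventually_sequentially)
    show "\<forall>\<^sub>F x in at_top. dist (h x) 0 < e"
      using iter[of n] by eventually_elim (use n in simp)
  qed
  then have "((\<lambda>x. h x + l) \<longlongrightarrow> 0 + l) at_top" by (intro tendsto_add tendsto_const)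
  then show ?thesis by (simp add: h_def l_def)
qed

section \<open>Classifying lattice points by their gcd\<close>

lemma mem_lattice_box_iff: "(a, b) \<in> lattice_box x y \<longleftrightarrow> \<bar>real_of_int a\<bar> \<le> x \<and> \<bar>real_of_int b\<bar> \<le> y"
  by (auto simp: lattice_box_def)

lemma lattice_box_origin:
  assumes "x < 1" "y < 1"
  shows "lattice_box x y \<subseteq> {(0, 0)}"
  using assms by (auto simp: mem_lattice_box_iff)

definition dilate :: "nat \<Rightarrow> int \<times> int \<Rightarrow> int \<times> int" where
  "dilate d = (\<lambda>(a, b). (int d * a, int d * b))"

lemma dilate_mem_lattice_box_iff:
  assumes "0 < d"
  shows "dilate d v \<in> lattice_box x y \<longleftrightarrow> v \<in> lattice_box (x / real d) (y / real d)"
  using assms by (cases v) (simp add: dilate_def mem_lattice_box_iff abs_mult pos_le_divide_eq mult.commute)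

text \<open>
  Sorting the points of \<open>P\<close> in a box by their gcd \<open>d\<close> and dividing by \<open>d\<close> gives primitive points
  in the box shrunk by \<open>d\<close>.  The gcd of a point of \<open>P\<close> in the box is at most \<open>n\<close>, because a box
  of half-widths below 1 contains at most the origin.
\<close>

lemma card_eq_sum_primitive:
  fixes P :: "(int \<times> int) set" and D :: "nat set"
  assumes origin: "(0, 0) \<notin> P"
    and dilate_P: "\<And>d v. 0 < d \<Longrightarrow> dilate d v \<in> P \<longleftrightarrow> d \<in> D \<and> v \<in> P"
    and n: "x < real n" "y < real n"
  shows "card (P \<inter> lattice_box x y) =
    (\<Sum>d \<in> {1..n} \<inter> D. card (P \<inter> prim_vecs \<inter> lattice_box (x / real d) (y / real d)))"
proof -
  define A where "A = (\<lambda>d. P \<inter> prim_vecs \<inter> lattice_box (x / real d) (y / real d))"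
  have gcd_dilate: "gcd (fst (dilate d v)) (snd (dilate d v)) = int d" if "v \<in> prim_vecs" for d v
    using that by (cases v) (simp add: dilate_def prim_vecs_def gcd_mult_distrib_int[symmetric])
  have "P \<inter> lattice_box x y = (\<Union>d \<in> {1..n} \<inter> D. dilate d ` A d)"
  proof (intro equalityI subsetI)
    fix v assume v: "v \<in> P \<inter> lattice_box x y"
    obtain a b where ab: "v = (a, b)" by (cases v)
    define d where "d = nat (gcd a b)"
    have nz: "a \<noteq> 0 \<or> b \<noteq> 0" using v ab origin by auto
    then have d: "int d = gcd a b" "0 < d" by (auto simp: d_def)
    obtain a' b' where ab': "a = a' * gcd a b" "b = b' * gcd a b" "coprime a' b'"
      using gcd_coprime_exists[of a b] nz by auto
    have vs: "v = dilate d (a', b')" using ab ab' d by (auto simp: dilate_def mult.commute)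
    have prim: "(a', b') \<in> prim_vecs" using ab'(3) by (simp add: prim_vecs_def)
    have "d \<in> D" "(a', b') \<in> P" using dilate_P[OF d(2), of "(a', b')"] v vs by auto
    moreover have box: "(a', b') \<in> lattice_box (x / real d) (y / real d)"
      using dilate_mem_lattice_box_iff[OF d(2), of "(a', b')"] v vs by auto
    moreover have "d \<le> n"
    proof (rule ccontr)
      assume "\<not> d \<le> n"
      then have "x / real d < 1" "y / real d < 1" using n d by (auto simp: pos_divide_less_eq)
      then show False using lattice_box_origin box origin \<open>(a', b') \<in> P\<close> by blast
    qed
    ultimately show "v \<in> (\<Union>d \<in> {1..n} \<inter> D. dilate d ` A d)"
      using d prim vs by (auto simp: A_def)
  next
    fix v assume "v \<in> (\<Union>d \<in> {1..n} \<inter> D. dilate d ` A d)"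
    then show "v \<in> P \<inter> lattice_box x y"
      by (auto simp: A_def dilate_P dilate_mem_lattice_box_iff)
  qed
  also have "card \<dots> = (\<Sum>d \<in> {1..n} \<inter> D. card (dilate d ` A d))"
  proof (rule card_UN_disjoint)
    show "\<forall>d \<in> {1..n} \<inter> D. finite (dilate d ` A d)"
      by (auto simp: A_def finite_lattice_box)
    show "\<forall>i \<in> {1..n} \<inter> D. \<forall>j \<in> {1..n} \<inter> D. i \<noteq> j \<longrightarrow> dilate i ` A i \<inter> dilate j ` A j = {}"
    proof (intro ballI impI equals0I)
      fix i j v assume "i \<noteq> j" "v \<in> dilate i ` A i \<inter> dilate j ` A j"
      then show False using gcd_dilate[of _ i] gcd_dilate[of _ j] by (auto simp: A_def) (metis of_nat_eq_iff)
    qed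
  qed simp
  also have "\<dots> = (\<Sum>d \<in> {1..n} \<inter> D. card (A d))"
    by (intro sum.cong refl card_image) (auto simp: inj_on_def dilate_def)
  finally show ?thesis by (simp add: A_def)
qed

section \<open>Counting all lattice points\<close>

definition int_interval :: "real \<Rightarrow> int set" where
  "int_interval x = {a. \<bar>real_of_int a\<bar> \<le> x}"

lemma int_interval_eq: "int_interval x = {-\<lfloor>x\<rfloor>..\<lfloor>x\<rfloor>}"
  by (auto simp: int_interval_def abs_le_iff le_floor_iff minus_le_iff)

lemma finite_int_interval: "finite (int_interval x)"
  by (simp add: int_interval_eq)

lemma card_int_interval:
  assumes "0 \<le> x"
  shows "real (card (int_interval x)) = 2 * \<lfloor>x\<rfloor> + 1"
  using assms by (simp add: int_interval_eq)

lemma card_Times_lattice_box: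
  "card (A \<times> B \<inter> lattice_box x y) = card (A \<inter> int_interval x) * card (B \<inter> int_interval y)"
proof -
  have "A \<times> B \<inter> lattice_box x y = (A \<inter> int_interval x) \<times> (B \<inter> int_interval y)"
    by (auto simp: mem_lattice_box_iff int_interval_def)
  then show ?thesis by (simp add: card_cartesian_product)
qed

lemma density_integers: "((\<lambda>x. real (card (int_interval x)) / (2 * x)) \<longlongrightarrow> 1) at_top"
proof (rule Lim_transform_eventually)
  show "((\<lambda>x::real. (2 * real_of_int \<lfloor>x\<rfloor> + 1) / (2 * x)) \<longlongrightarrow> 1) at_top"
    by real_asymp
  show "\<forall>\<^sub>F x in at_top. (2 * real_of_int \<lfloor>x\<rfloor> + 1) / (2 * x) = real (card (int_interval x)) / (2 * x)"
    using eventually_ge_at_top[of 0] by eventually_elim (simp add: card_int_interval)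
qed

text \<open>
  The multiples of \<open>p\<close> in \<open>[-x, x]\<close> correspond to the integers in \<open>[-x / p, x / p]\<close>.
\<close>

lemma density_nonmultiples:
  assumes "0 < p"
  shows "((\<lambda>x. real (card ({a. \<not> int p dvd a} \<inter> int_interval x)) / (2 * x)) \<longlongrightarrow> 1 - 1 / real p) at_top"
proof (rule Lim_transform_eventually)
  have "filterlim (\<lambda>x. x / real p) at_top at_top" using assms by real_asymp
  from filterlim_compose[OF density_integers this]
  have "((\<lambda>x. real (card (int_interval (x / real p))) / (2 * (x / real p))) \<longlongrightarrow> 1) at_top" .
  then show "((\<lambda>x. real (card (int_interval x)) / (2 * x) -
      real (card (int_interval (x / real p))) / (2 * (x / real p)) / real p) \<longlongrightarrow> 1 - 1 / real p) at_top"
    by (intro tendsto_intros density_integers) (use assms in auto)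
  show "\<forall>\<^sub>F x in at_top. real (card (int_interval x)) / (2 * x) -
      real (card (int_interval (x / real p))) / (2 * (x / real p)) / real p =
      real (card ({a. \<not> int p dvd a} \<inter> int_interval x)) / (2 * x)"
  proof (rule always_eventually, rule allI)
    fix x
    have "int_interval x = ({a. \<not> int p dvd a} \<inter> int_interval x) \<union> (*) (int p) ` int_interval (x / real p)"
      using assms by (auto simp: int_interval_def abs_mult pos_le_divide_eq mult.commute elim!: dvdE)
    then have "card (int_interval x) =
        card ({a. \<not> int p dvd a} \<inter> int_interval x) + card ((*) (int p) ` int_interval (x / real p))"
      by (subst card_Un_disjoint[symmetric]) (auto simp: finite_int_interval)
    also have "card ((*) (int p) ` int_interval (x / real p)) = card (int_interval (x / real p))"
      using assms by (intro card_image) (auto simp: inj_on_def)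
    finally show "real (card (int_interval x)) / (2 * x) -
      real (card (int_interval (x / real p))) / (2 * (x / real p)) / real p =
      real (card ({a. \<not> int p dvd a} \<inter> int_interval x)) / (2 * x)"
      using assms by (simp add: add_divide_distrib)
  qed
qed

lemma density_Times:
  assumes "0 < \<alpha>" "0 < \<beta>"
    and "((\<lambda>x. real (card (A \<inter> int_interval x)) / (2 * x)) \<longlongrightarrow> \<delta>) at_top"
    and "((\<lambda>x. real (card (B \<inter> int_interval x)) / (2 * x)) \<longlongrightarrow> \<epsilon>) at_top"
  shows "((\<lambda>R. real (card (A \<times> B \<inter> lattice_box (\<alpha> * R) (\<beta> * R))) / ((2 * \<alpha> * R) * (2 * \<beta> * R)))
    \<longlongrightarrow> \<delta> * \<epsilon>) at_top"
proof -
  have "filterlim (\<lambda>R. \<alpha> * R) at_top at_top" "filterlim (\<lambda>R. \<beta> * R) at_top at_top"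
    using assms(1,2) by real_asymp+
  from tendsto_mult[OF filterlim_compose[OF assms(3) this(1)] filterlim_compose[OF assms(4) this(2)]]
  show ?thesis by (simp add: card_Times_lattice_box mult.assoc)
qed

text \<open>
  This makes the normalised count bounded for all \<open>R > 0\<close>, including small ones.  There it
  is essential that the origin is excluded: the remaining bound
  \<open>4 * \<lfloor>x\<rfloor> * \<lfloor>y\<rfloor> + 2 * \<lfloor>x\<rfloor> + 2 * \<lfloor>y\<rfloor>\<close> is quadratic even near 0, since \<open>\<lfloor>z\<rfloor> \<le> z\<^sup>2\<close>.
\<close>

lemma card_lattice_box_le:
  assumes "0 \<le> x" "0 \<le> y" and "(0, 0) \<notin> P"
  shows "real (card (P \<inter> lattice_box x y)) \<le> 4 * x * y + 2 * x\<^sup>2 + 2 * y\<^sup>2"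
proof -
  have floor_le: "0 \<le> real_of_int \<lfloor>z\<rfloor>" "real_of_int \<lfloor>z\<rfloor> \<le> z" "real_of_int \<lfloor>z\<rfloor> \<le> z\<^sup>2" if "0 \<le> z" for z :: real
  proof -
    show "0 \<le> real_of_int \<lfloor>z\<rfloor>" "real_of_int \<lfloor>z\<rfloor> \<le> z" using that by auto
    show "real_of_int \<lfloor>z\<rfloor> \<le> z\<^sup>2"
    proof (cases "z < 1")
      case True
      then have "\<lfloor>z\<rfloor> = 0" using that by linarith
      then show ?thesis by simp
    next
      case False
      then have "z * 1 \<le> z * z" by (intro mult_left_mono) auto
      then show ?thesis using of_int_floor_le[of z] unfolding power2_eq_square by linarith
    qed
  qed
  have "card (insert (0, 0) (P \<inter> lattice_box x y)) \<le> card (UNIV \<times> UNIV \<inter> lattice_box x y)"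
    by (rule card_mono) (use assms in \<open>auto simp: finite_lattice_box mem_lattice_box_iff\<close>)
  also have "\<dots> = card (int_interval x) * card (int_interval y)"
    by (subst card_Times_lattice_box) simp
  finally have "card (P \<inter> lattice_box x y) + 1 \<le> card (int_interval x) * card (int_interval y)"
    using assms by (simp add: finite_lattice_box)
  then have "real (card (P \<inter> lattice_box x y) + 1) \<le> real (card (int_interval x) * card (int_interval y))"
    by (simp only: of_nat_le_iff)
  then have "real (card (P \<inter> lattice_box x y)) + 1 \<le> (2 * \<lfloor>x\<rfloor> + 1) * (2 * \<lfloor>y\<rfloor> + 1)"
    using card_int_interval[OF assms(1)] card_int_interval[OF assms(2)] by simp
  then have "real (card (P \<inter> lattice_box x y)) \<le> 4 * (\<lfloor>x\<rfloor> * \<lfloor>y\<rfloor>) + 2 * \<lfloor>x\<rfloor> + 2 * \<lfloor>y\<rfloor>"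
    by (simp add: algebra_simps)
  moreover have "real_of_int \<lfloor>x\<rfloor> * real_of_int \<lfloor>y\<rfloor> \<le> x * y"
    using floor_le[OF assms(1)] floor_le[OF assms(2)] by (intro mult_mono) auto
  ultimately show ?thesis
    using floor_le(3)[OF assms(1)] floor_le(3)[OF assms(2)] by (simp add: algebra_simps)
qed

section \<open>Densities of primitive points\<close>

text \<open>
  Removing the multiples of \<open>p\<close>, which contribute \<open>\<zeta>(2) / p\<^sup>2\<close>, from the series for \<open>\<zeta>(2)\<close>.
  The index \<open>d = 0\<close> contributes nothing, as \<open>1 / 0 = 0\<close>.
\<close>

lemma inverse_squares_coprime_sums:
  assumes "prime p"
  shows "(\<lambda>d. if coprime d p then 1 / (real d)\<^sup>2 else 0) sums (pi\<^sup>2 / 6 * (1 - 1 / (real p)\<^sup>2))"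
proof -
  have p: "0 < p" using assms prime_gt_0_nat by auto
  have all: "(\<lambda>d. 1 / (real d)\<^sup>2) sums (pi\<^sup>2 / 6)"
    using sums_Suc[of "\<lambda>d. 1 / (real d)\<^sup>2" "pi\<^sup>2 / 6"] inverse_squares_sums by (simp add: add_ac)
  have "(\<lambda>k. 1 / (real (p * k))\<^sup>2) sums (pi\<^sup>2 / 6 * (1 / (real p)\<^sup>2))"
    using sums_mult2[OF all, of "1 / (real p)\<^sup>2"] by (simp add: power_mult_distrib mult.commute)
  then have "(\<lambda>k. if p dvd p * k then 1 / (real (p * k))\<^sup>2 else 0) sums (pi\<^sup>2 / 6 * (1 / (real p)\<^sup>2))"
    by simp
  moreover have "strict_mono (\<lambda>k. p * k)" using p by (simp add: strict_mono_def)
  ultimately have "(\<lambda>d. if p dvd d then 1 / (real d)\<^sup>2 else 0) sums (pi\<^sup>2 / 6 * (1 / (real p)\<^sup>2))"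
    by (subst (asm) sums_mono_reindex[where f = "\<lambda>d. if p dvd d then 1 / (real d)\<^sup>2 else 0"]) auto
  from sums_diff[OF all this]
  have "(\<lambda>d. 1 / (real d)\<^sup>2 - (if p dvd d then 1 / (real d)\<^sup>2 else 0)) sums (pi\<^sup>2 / 6 * (1 - 1 / (real p)\<^sup>2))"
    by (simp add: right_diff_distrib)
  moreover have "coprime d p \<longleftrightarrow> \<not> p dvd d" for d
    using assms by (metis coprime_commute prime_imp_coprime coprime_absorb_left not_prime_unit)
  ultimately show ?thesis
    by (elim sums_cong[THEN iffD1, rotated]) auto
qed

text \<open>
  Equivalently \<open>\<zeta>(2) < 2\<close>, which is what the contraction argument needs.  From \<open>1 / 2\<^sup>2\<close> on, the
  series for \<open>\<zeta>(2)\<close> is compared with the telescoping series of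
  \<open>1 / (k - 1 / 2) - 1 / (k + 1 / 2) = 1 / (k\<^sup>2 - 1 / 4)\<close>, whose sum over \<open>k \<ge> 2\<close> is \<open>2 / 3\<close>.
\<close>

lemma pi_squared_less_12: "pi\<^sup>2 < 12"
proof -
  have lim: "(\<lambda>n. 1 / (real n + 3 / 2)) \<longlonglongrightarrow> 0" by real_asymp
  from telescope_sums'[OF lim]
  have upper: "(\<lambda>n. 1 / (real n + 3 / 2) - 1 / (real n + 5 / 2)) sums (2 / 3)"
    by (simp add: add_ac)
  have lower: "(\<lambda>n. 1 / (real n + 2)\<^sup>2) sums (pi\<^sup>2 / 6 - 1)"
    using inverse_squares_sums sums_Suc_iff[of "\<lambda>n. 1 / (real n + 1)\<^sup>2" "pi\<^sup>2 / 6 - 1"]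
    by (simp add: add_ac)
  have le: "1 / (real n + 2)\<^sup>2 \<le> 1 / (real n + 3 / 2) - 1 / (real n + 5 / 2)" for n
  proof -
    have "1 / (real n + 3 / 2) - 1 / (real n + 5 / 2) = 1 / ((real n + 3 / 2) * (real n + 5 / 2))"
      by (simp add: field_simps)
    moreover have "(real n + 3 / 2) * (real n + 5 / 2) \<le> (real n + 2)\<^sup>2"
      by (simp add: power2_eq_square algebra_simps)
    ultimately show ?thesis by (simp add: frac_le)
  qed
  from sums_le[OF le lower upper] have "pi\<^sup>2 / 6 - 1 \<le> 2 / 3" .
  then show ?thesis by simp
qed

text \<open>
  The classification by gcd, divided by the area of the box, is a dilation sum with weights
  \<open>1 / d\<^sup>2\<close>, because the box for \<open>R / d\<close> has \<open>1 / d\<^sup>2\<close> times the area.  For given \<open>R\<close> only finitely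
  many terms are nonzero.
\<close>

lemma density_primitive:
  assumes "prime p" "0 < \<alpha>" "0 < \<beta>" and origin: "(0, 0) \<notin> P"
    and dilate_P: "\<And>d v. 0 < d \<Longrightarrow> dilate d v \<in> P \<longleftrightarrow> coprime d p \<and> v \<in> P"
    and lim: "((\<lambda>R. real (card (P \<inter> lattice_box (\<alpha> * R) (\<beta> * R))) / ((2 * \<alpha> * R) * (2 * \<beta> * R)))
      \<longlongrightarrow> \<delta>) at_top"
  shows "((\<lambda>R. real (card (P \<inter> prim_vecs \<inter> lattice_box (\<alpha> * R) (\<beta> * R))) / ((2 * \<alpha> * R) * (2 * \<beta> * R)))
    \<longlongrightarrow> \<delta> / (pi\<^sup>2 / 6 * (1 - 1 / (real p)\<^sup>2))) at_top"
proof (rule tendsto_of_dilation_sum)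
  let ?w = "\<lambda>d. if coprime d p then 1 / (real d)\<^sup>2 else 0"
  let ?f = "\<lambda>R. real (card (P \<inter> prim_vecs \<inter> lattice_box (\<alpha> * R) (\<beta> * R)))"
  let ?g = "\<lambda>R. ?f R / ((2 * \<alpha> * R) * (2 * \<beta> * R))"
  show "?w sums (pi\<^sup>2 / 6 * (1 - 1 / (real p)\<^sup>2))"
    using assms(1) by (rule inverse_squares_coprime_sums)
  have "pi\<^sup>2 / 6 * (1 - 1 / (real p)\<^sup>2) \<le> pi\<^sup>2 / 6 * 1" by (intro mult_left_mono) auto
  also have "\<dots> < 2" using pi_squared_less_12 by simp
  finally show "pi\<^sup>2 / 6 * (1 - 1 / (real p)\<^sup>2) < 2" .
  show "\<bar>?g R\<bar> \<le> (4 * \<alpha> * \<beta> + 2 * \<alpha>\<^sup>2 + 2 * \<beta>\<^sup>2) / (4 * \<alpha> * \<beta>)" if "0 < R" for R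
  proof -
    have "?f R \<le> 4 * (\<alpha> * R) * (\<beta> * R) + 2 * (\<alpha> * R)\<^sup>2 + 2 * (\<beta> * R)\<^sup>2"
      using assms that by (intro card_lattice_box_le) auto
    also have "\<dots> = (4 * \<alpha> * \<beta> + 2 * \<alpha>\<^sup>2 + 2 * \<beta>\<^sup>2) * R\<^sup>2"
      by (simp add: power2_eq_square algebra_simps)
    finally have "?f R / ((2 * \<alpha> * R) * (2 * \<beta> * R)) \<le>
        (4 * \<alpha> * \<beta> + 2 * \<alpha>\<^sup>2 + 2 * \<beta>\<^sup>2) * R\<^sup>2 / ((2 * \<alpha> * R) * (2 * \<beta> * R))"
      using assms that by (intro divide_right_mono) auto
    also have "\<dots> = (4 * \<alpha> * \<beta> + 2 * \<alpha>\<^sup>2 + 2 * \<beta>\<^sup>2) / (4 * \<alpha> * \<beta>)"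
      using assms that by (simp add: power2_eq_square field_simps)
    finally show ?thesis using assms that by simp
  qed
  show "((\<lambda>R. \<Sum>d. ?w d * ?g (R / real d)) \<longlongrightarrow> \<delta>) at_top"
  proof (rule Lim_transform_eventually[OF lim])
    show "\<forall>\<^sub>F R in at_top. real (card (P \<inter> lattice_box (\<alpha> * R) (\<beta> * R))) / ((2 * \<alpha> * R) * (2 * \<beta> * R))
        = (\<Sum>d. ?w d * ?g (R / real d))"
      using eventually_gt_at_top[of 0]
    proof eventually_elim
      case (elim R)
      obtain n where "max (\<alpha> * R) (\<beta> * R) < real n" using reals_Archimedean2 by blast
      then have n: "\<alpha> * R < real n" "\<beta> * R < real n" by auto
      let ?c = "\<lambda>d. card (P \<inter> prim_vecs \<inter> lattice_box (\<alpha> * R / real d) (\<beta> * R / real d))"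
      have term_eq: "?w d * ?g (R / real d) = (if coprime d p then ?c d / ((2 * \<alpha> * R) * (2 * \<beta> * R)) else 0)"
        if "0 < d" for d using elim that assms by (simp add: field_simps power2_eq_square)
      have "(\<Sum>d. ?w d * ?g (R / real d)) = (\<Sum>d \<in> {1..n} \<inter> {d. coprime d p}. ?w d * ?g (R / real d))"
      proof (rule suminf_finite)
        fix d assume d: "d \<notin> {1..n} \<inter> {d. coprime d p}"
        show "?w d * ?g (R / real d) = 0"
        proof (cases "n < d")
          case True
          then have "\<alpha> * (R / real d) < 1" "\<beta> * (R / real d) < 1"
            using n by (auto simp: pos_divide_less_eq)
          from lattice_box_origin[OF this] origin
          have "P \<inter> prim_vecs \<inter> lattice_box (\<alpha> * (R / real d)) (\<beta> * (R / real d)) = {}" by blast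
          then show ?thesis by simp
        next
          case False
          then show ?thesis using d by (cases "d = 0") auto
        qed
      qed simp
      also have "\<dots> = (\<Sum>d \<in> {1..n} \<inter> {d. coprime d p}. real (?c d) / ((2 * \<alpha> * R) * (2 * \<beta> * R)))"
        by (intro sum.cong refl) (subst term_eq, auto)
      also have "\<dots> = real (card (P \<inter> lattice_box (\<alpha> * R) (\<beta> * R))) / ((2 * \<alpha> * R) * (2 * \<beta> * R))"
        using card_eq_sum_primitive[of P "{d. coprime d p}", OF origin _ n] dilate_P
        by (simp add: sum_divide_distrib)
      finally show ?case by simp
    qed
  qed
qed auto

lemma dvd_mult_iff_coprime_imp:
  assumes "prime p"
  shows "int p dvd int d * a \<longleftrightarrow> (coprime d p \<longrightarrow> int p dvd a)"
proof -
  have "coprime d p \<longleftrightarrow> \<not> int p dvd int d"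
    using assms by (metis coprime_commute prime_imp_coprime coprime_absorb_left not_prime_unit int_dvd_int_iff)
  then show ?thesis using assms by (auto simp: prime_dvd_mult_iff)
qed

theorem corollary4:
  fixes p :: nat and \<alpha> \<beta> :: real
  assumes "prime p" and "\<alpha> \<in> {0<..1}" and "\<beta> \<in> {0<..1}"
  shows "((\<lambda>R::real. real (card (C_prim p \<inter> lattice_box (\<alpha> * R) (\<beta> * R)))
            / ((2 * \<alpha> * R) * (2 * \<beta> * R)))
          \<longlongrightarrow> 6 / pi\<^sup>2 * (real p / (real p + 1))) at_top
       \<and> ((\<lambda>R::real. real (card (D_prim p \<inter> lattice_box (\<alpha> * R) (\<beta> * R)))
            / ((2 * \<alpha> * R) * (2 * \<beta> * R)))
          \<longlongrightarrow> 6 / pi\<^sup>2 * (real p / (real p + 1))) at_top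
       \<and> ((\<lambda>R::real. real (card (E_prim p \<inter> lattice_box (\<alpha> * R) (\<beta> * R)))
            / ((2 * \<alpha> * R) * (2 * \<beta> * R)))
          \<longlongrightarrow> 6 / pi\<^sup>2 * ((real p - 1) / (real p + 1))) at_top"
proof -
  have \<alpha>\<beta>: "0 < \<alpha>" "0 < \<beta>" using assms by auto
  have p: "1 < real p" "0 < p" using assms(1) prime_gt_1_nat[of p] by auto
  let ?U = "{a. \<not> int p dvd a}"
  have sets: "C_prim p = ?U \<times> UNIV \<inter> prim_vecs" "D_prim p = UNIV \<times> ?U \<inter> prim_vecs"
    "E_prim p = ?U \<times> ?U \<inter> prim_vecs"
    by (auto simp: C_prim_def D_prim_def E_prim_def cong_0_iff)
  have U: "((\<lambda>x. real (card (?U \<inter> int_interval x)) / (2 * x)) \<longlongrightarrow> 1 - 1 / real p) at_top"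
    using p by (intro density_nonmultiples)
  have V: "((\<lambda>x. real (card (UNIV \<inter> int_interval x)) / (2 * x)) \<longlongrightarrow> 1) at_top"
    using density_integers by simp
  have factor: "1 - 1 / (real p)\<^sup>2 = (1 - 1 / real p) * ((real p + 1) / real p)" "1 - 1 / real p \<noteq> 0"
    using p by (auto simp: field_simps power2_eq_square)
  have lim_C: "(1 - 1 / real p) * 1 / (pi\<^sup>2 / 6 * (1 - 1 / (real p)\<^sup>2)) = 6 / pi\<^sup>2 * (real p / (real p + 1))"
    unfolding factor(1) using factor(2) p by (simp add: divide_simps)
  have lim_E: "(1 - 1 / real p) * (1 - 1 / real p) / (pi\<^sup>2 / 6 * (1 - 1 / (real p)\<^sup>2)) =
      6 / pi\<^sup>2 * ((real p - 1) / (real p + 1))"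
  proof -
    have "(1 - 1 / real p) * (1 - 1 / real p) / (pi\<^sup>2 / 6 * (1 - 1 / (real p)\<^sup>2)) =
        6 / pi\<^sup>2 * (real p / (real p + 1)) * (1 - 1 / real p)"
      unfolding lim_C[symmetric] by simp
    also have "\<dots> = 6 / pi\<^sup>2 * ((real p - 1) / (real p + 1))" using p by (simp add: divide_simps)
    finally show ?thesis .
  qed
  note dilate_simps = dilate_def dvd_mult_iff_coprime_imp[OF assms(1)]
  have "((\<lambda>R. real (card (C_prim p \<inter> lattice_box (\<alpha> * R) (\<beta> * R))) / ((2 * \<alpha> * R) * (2 * \<beta> * R)))
      \<longlongrightarrow> 6 / pi\<^sup>2 * (real p / (real p + 1))) at_top"
    unfolding sets lim_C[symmetric]
    by (rule density_primitive[OF assms(1) \<alpha>\<beta> _ _ density_Times[OF \<alpha>\<beta> U V]]) (auto simp: dilate_simps)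
  moreover have "((\<lambda>R. real (card (D_prim p \<inter> lattice_box (\<alpha> * R) (\<beta> * R))) / ((2 * \<alpha> * R) * (2 * \<beta> * R)))
      \<longlongrightarrow> 6 / pi\<^sup>2 * (real p / (real p + 1))) at_top"
    unfolding sets lim_C[symmetric] mult.commute[of "1 - 1 / real p" 1]
    by (rule density_primitive[OF assms(1) \<alpha>\<beta> _ _ density_Times[OF \<alpha>\<beta> V U]]) (auto simp: dilate_simps)
  moreover have "((\<lambda>R. real (card (E_prim p \<inter> lattice_box (\<alpha> * R) (\<beta> * R))) / ((2 * \<alpha> * R) * (2 * \<beta> * R)))
      \<longlongrightarrow> 6 / pi\<^sup>2 * ((real p - 1) / (real p + 1))) at_top"
    unfolding sets lim_E[symmetric]
    by (rule density_primitive[OF assms(1) \<alpha>\<beta> _ _ density_Times[OF \<alpha>\<beta> U U]]) (auto simp: dilate_simps)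
  ultimately show ?thesis by blast
qed

end
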